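(* Let $\tilde{x}_k$ be the $k$-th iterate of the randomized Kaczmarz (RK) method applied to the doubly noisy linear system $\widetilde{A}x=\tilde{b}$. Let $x_{LS}=A^{\dagger}b$ and $\tilde{x}_{LS}=\widetilde{A}^{\dagger}\tilde{b}$ be the least-squares solutions of the noiseless system $Ax=b$ and of the doubly noisy system $\widetilde{A}x=\tilde{b}$, respectively. Then for any initial point $\tilde{x}_0\in\mathbb{R}^n$ and any positive integer $k$, $$\|\mathbb{E}(\tilde{x}_k-x_{LS})\|_2\le\alpha^k\left\|(\tilde{x}_0-x_{LS})_{\mathcal{R}(\widetilde{A}^{\top})}\right\|_2+\beta\left\|(x_{LS}-\tilde{x}_{LS})_{\mathcal{R}(\widetilde{A}^{\top})}\right\|_2+\left\|(\tilde{x}_0-x_{LS})_{\mathcal{N}(\widetilde{A})}\right\|_2,$$ where $\alpha=1-\frac{\sigma_{\min}^2(\widetilde{A})}{\|\widetilde{A}\|_F^2}$ and $\beta=1-\left(1-\frac{\sigma_{\max}^2(\widetilde{A})}{\|\widetilde{A}\|_F^2}\right)^k$.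
   Context: $A,\widetilde{A}\in\mathbb{R}^{m\times n}$ and $b,\tilde{b}\in\mathbb{R}^m$ are fixed (deterministic), $\widetilde{A}\neq 0$; $\widetilde{A},\tilde{b}$ are noisy versions of $A,b$. Neither $Ax=b$ nor $\widetilde{A}x=\tilde{b}$ is assumed consistent. $M^{\dagger}$ is the Moore-Penrose inverse, $\mathcal{R}(\cdot)$ and $\mathcal{N}(\cdot)$ denote range and null space, $\|\cdot\|_F$ is the Frobenius norm, $\sigma_{\min}(\widetilde{A})$ is the smallest nonzero singular value and $\sigma_{\max}(\widetilde{A})$ the largest singular value of $\widetilde{A}$, and $(x)_{V}$ is the (Euclidean) orthogonal projection of $x$ onto the subspace $V$. RK method: let $\tilde{a}_i^{\top}$ be the $i$-th row of $\widetilde{A}$ and $\tilde{b}_i$ the $i$-th entry of $\tilde{b}$. Starting from $\tilde{x}_0$, at step $k=1,2,\dots$ an index $i_k\in\{1,\dots,m\}$ is drawn, independently of the past, with probability $\mathbb{P}(i_k=i)=\|\tilde{a}_i\|_2^2/\|\widetilde{A}\|_F^2$, and $$\tilde{x}_k=\tilde{x}_{k-1}-\frac{\tilde{a}_{i_k}^{\top}\tilde{x}_{k-1}-\tilde{b}_{i_k}}{\|\tilde{a}_{i_k}\|_2^2}\,\tilde{a}_{i_k}.$$ $\mathbb{E}$ denotes expectation over all random index choices. *)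

theory Defs
  imports "HOL-Probability.Probability"
begin

definition matrix_range :: "real^'n^'m \<Rightarrow> (real^'m) set" where
  "matrix_range A = range (\<lambda>x. A *v x)"

definition matrix_null :: "real^'n^'m \<Rightarrow> (real^'n) set" where
  "matrix_null A = {x. A *v x = 0}"

text \<open>Meaningful when \<open>V\<close> is a subspace, see \<open>orth_proj_unique_exists\<close>.\<close>

definition orth_proj :: "'a::euclidean_space set \<Rightarrow> 'a \<Rightarrow> 'a" where
  "orth_proj V x = (THE y. y \<in> V \<and> (\<forall>v\<in>V. orthogonal (x - y) v))"

lemma inner_transpose: "(transpose M *v x) \<bullet> y = x \<bullet> (M *v y)" for M :: "real^'n^'m"
  by (metis dot_lmul_matrix transpose_matrix_vector)

lemma subspace_matrix_range: "subspace (matrix_range A)"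
  unfolding matrix_range_def
  using linear_subspace_image[OF matrix_vector_mul_linear subspace_UNIV] .

lemma orth_proj_unique:
  fixes x y z :: "'a::euclidean_space"
  assumes "subspace V" "y \<in> V" "\<And>v. v \<in> V \<Longrightarrow> orthogonal (x - y) v"
    and "z \<in> V" "\<And>v. v \<in> V \<Longrightarrow> orthogonal (x - z) v"
  shows "y = z"
proof -
  have d: "y - z \<in> V" using assms by (simp add: subspace_diff)
  have "(y - z) \<bullet> (y - z) = (x - z) \<bullet> (y - z) - (x - y) \<bullet> (y - z)"
    by (simp add: inner_diff)
  also have "\<dots> = 0" using assms(3,5)[OF d] by (simp add: orthogonal_def)
  finally show ?thesis by simp
qed

lemma orth_proj_unique_exists:
  fixes x :: "'a::euclidean_space"
  assumes "subspace V"
  shows "\<exists>!y. y \<in> V \<and> (\<forall>v\<in>V. orthogonal (x - y) v)"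
proof -
  have V: "span V = V" using assms by (simp add: span_eq_iff)
  obtain y z where "y \<in> span V" "\<And>w. w \<in> span V \<Longrightarrow> orthogonal z w" "x = y + z"
    using orthogonal_subspace_decomp_exists[of V x] by blast
  then have "y \<in> V \<and> (\<forall>v\<in>V. orthogonal (x - y) v)" using V by simp
  then show ?thesis using orth_proj_unique[OF assms] by blast
qed

lemma orth_proj_props:
  assumes "subspace V"
  shows "orth_proj V x \<in> V" "\<And>v. v \<in> V \<Longrightarrow> orthogonal (x - orth_proj V x) v"
  using theI'[OF orth_proj_unique_exists[OF assms, of x]] unfolding orth_proj_def by blast+

lemma orth_proj_eqI:
  assumes "subspace V" "y \<in> V" "\<And>v. v \<in> V \<Longrightarrow> orthogonal (x - y) v"
  shows "orth_proj V x = y"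
  using orth_proj_unique[OF assms(1) orth_proj_props[OF assms(1)] assms(2,3)] by blast

lemma linear_orth_proj:
  assumes "subspace V"
  shows "linear (orth_proj V)"
proof (rule linearI)
  note p = orth_proj_props[OF assms]
  show "orth_proj V (x + y) = orth_proj V x + orth_proj V y" for x y
  proof (intro orth_proj_eqI assms subspace_add p)
    fix v assume "v \<in> V"
    then show "orthogonal (x + y - (orth_proj V x + orth_proj V y)) v"
      using p(2)[of v x] p(2)[of v y] by (simp add: orthogonal_def algebra_simps)
  qed
  show "orth_proj V (c *\<^sub>R x) = c *\<^sub>R orth_proj V x" for c x
  proof (intro orth_proj_eqI assms subspace_scale p)
    fix v assume "v \<in> V"
    then show "orthogonal (c *\<^sub>R x - c *\<^sub>R orth_proj V x) v"
      using p(2)[of v x] by (simp add: orthogonal_def inner_diff_left)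
  qed
qed

lemma orth_proj_self_adjoint:
  assumes "subspace V"
  shows "orth_proj V x \<bullet> y = x \<bullet> orth_proj V y"
proof -
  note p = orth_proj_props[OF assms]
  have 1: "(x - orth_proj V x) \<bullet> orth_proj V y = 0"
    using p(2)[OF p(1)] unfolding orthogonal_def .
  have 2: "(y - orth_proj V y) \<bullet> orth_proj V x = 0"
    using p(2)[OF p(1)] unfolding orthogonal_def .
  show ?thesis using 1 2 inner_commute[of y] inner_commute[of "orth_proj V y"]
    by (simp add: inner_diff_left)
qed

text \<open>The four Penrose equations; they have exactly one solution, see \<open>is_pinv_exists\<close> and
  \<open>is_pinv_unique\<close>.\<close>

definition is_pinv :: "real^'n^'m \<Rightarrow> real^'m^'n \<Rightarrow> bool" where
  "is_pinv A X \<longleftrightarrow>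
     A ** X ** A = A \<and> X ** A ** X = X \<and>
     transpose (A ** X) = A ** X \<and> transpose (X ** A) = X ** A"

definition pinv :: "real^'n^'m \<Rightarrow> real^'m^'n" where
  "pinv A = (THE X. is_pinv A X)"

lemma is_pinv_unique:
  assumes X: "is_pinv A X" and Y: "is_pinv A Y"
  shows "X = Y"
proof -
  note d = is_pinv_def
  have "A ** X = (A ** Y ** A) ** X" using Y by (simp add: d)
  also have "\<dots> = (A ** Y) ** (A ** X)" by (simp add: matrix_mul_assoc)
  also have "\<dots> = transpose ((A ** X) ** (A ** Y))"
    using X Y by (simp add: d matrix_transpose_mul)
  also have "(A ** X) ** (A ** Y) = A ** Y" using X by (simp add: d matrix_mul_assoc)
  finally have 1: "A ** X = A ** Y" using Y by (simp add: d)
  have "X ** A = X ** (A ** Y ** A)" using Y by (simp add: d)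
  also have "\<dots> = (X ** A) ** (Y ** A)" by (simp add: matrix_mul_assoc)
  also have "\<dots> = transpose ((Y ** A) ** (X ** A))"
    using X Y by (simp add: d matrix_transpose_mul)
  also have "(Y ** A) ** (X ** A) = Y ** (A ** X ** A)" by (simp add: matrix_mul_assoc)
  also have "\<dots> = Y ** A" using X by (simp add: d)
  finally have 2: "X ** A = Y ** A" using Y by (simp add: d)
  have "X = X ** (A ** X)" using X by (simp add: d matrix_mul_assoc)
  also have "\<dots> = (X ** A) ** Y" by (simp add: 1 matrix_mul_assoc)
  also have "\<dots> = Y" using Y by (simp add: 2 d)
  finally show ?thesis .
qed

lemma is_pinv_exists:
  fixes A :: "real^'n^'m"
  shows "\<exists>X. is_pinv A X"
proof -
  define S where "S = matrix_range (transpose A)"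
  define R where "R = matrix_range A"
  have sS: "subspace S" and sR: "subspace R"
    unfolding S_def R_def by (rule subspace_matrix_range)+
  note pS = orth_proj_props[OF sS] and pR = orth_proj_props[OF sR]
  have perp: "A *v x = 0" if "\<And>v. v \<in> S \<Longrightarrow> orthogonal x v" for x
  proof -
    have "transpose A *v (A *v x) \<in> S" by (simp add: S_def matrix_range_def)
    then have "x \<bullet> (transpose A *v (A *v x)) = 0" using that by (simp add: orthogonal_def)
    then show ?thesis using inner_transpose[of A "A *v x" x] by (simp add: inner_commute)
  qed
  have AQ: "A *v orth_proj S x = A *v x" for x
    using perp[OF pS(2), of x] by (simp add: matrix_vector_mult_diff_distrib)
  have "inj_on ((*v) A) S"
  proof (rule inj_onI)
    fix x y assume xy: "x \<in> S" "y \<in> S" "A *v x = A *v y"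
    then obtain z where z: "x - y = transpose A *v z"
      using subspace_diff[OF sS, of x y] by (auto simp: S_def matrix_range_def)
    have "(x - y) \<bullet> (x - y) = z \<bullet> (A *v (x - y))"
      unfolding inner_transpose[symmetric] z ..
    then show "x = y" using xy(3) by (simp add: matrix_vector_mult_diff_distrib)
  qed
  then obtain g where g: "g ` UNIV \<subseteq> S" "linear g" "\<And>v. v \<in> S \<Longrightarrow> g (A *v v) = v"
    using linear_exists_left_inverse_on[OF matrix_vector_mul_linear[of A] sS] by blast
  define X where "X = matrix (\<lambda>y. g (orth_proj R y))"
  have X: "X *v y = g (orth_proj R y)" for y
    unfolding X_def
    using linear_compose[OF linear_orth_proj[OF sR] g(2)] by (simp add: o_def matrix_works)
  have PA: "orth_proj R (A *v x) = A *v x" for x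
    by (rule orth_proj_eqI[OF sR]) (auto simp: R_def matrix_range_def orthogonal_def)
  have XA: "X *v (A *v x) = orth_proj S x" for x
    using g(3)[OF pS(1), of x] by (simp add: X PA AQ)
  have AX: "A *v (X *v y) = orth_proj R y" for y
  proof -
    obtain z where z: "orth_proj R y = A *v z" using pR(1)[of y] by (auto simp: R_def matrix_range_def)
    have "X *v y = orth_proj S z" using XA[of z] unfolding X PA z .
    then show ?thesis by (simp add: AQ z)
  qed
  have PP: "orth_proj R (orth_proj R y) = orth_proj R y" for y
    by (metis PA AX)
  have sym: "transpose M = M" if "\<And>x y. (M *v x) \<bullet> y = x \<bullet> (M *v y)" for M :: "real^'k^'k"
  proof -
    have "transpose M *v x = M *v x" for x
    proof (rule vector_eq_rdot[THEN iffD1], rule allI)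
      fix y show "(transpose M *v x) \<bullet> y = (M *v x) \<bullet> y"
        using that[of x y] by (simp only: inner_transpose)
    qed
    then show ?thesis by (simp add: matrix_eq)
  qed
  have "is_pinv A X" unfolding is_pinv_def
  proof (intro conjI sym)
    show "A ** X ** A = A" 
      by (simp add: matrix_eq matrix_vector_mul_assoc[symmetric] XA AQ)
    show "X ** A ** X = X" 
      by (simp add: matrix_eq matrix_vector_mul_assoc[symmetric] AX) (simp add: X PP)
    show "((A ** X) *v x) \<bullet> y = x \<bullet> ((A ** X) *v y)" for x y
      by (simp add: matrix_vector_mul_assoc[symmetric] AX orth_proj_self_adjoint[OF sR])
    show "((X ** A) *v x) \<bullet> y = x \<bullet> ((X ** A) *v y)" for x y
      by (simp add: matrix_vector_mul_assoc[symmetric] XA orth_proj_self_adjoint[OF sS])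
  qed
  then show ?thesis by blast
qed

lemma is_pinv_pinv: "is_pinv A (pinv A)"
  unfolding pinv_def using is_pinv_exists[of A] is_pinv_unique by (metis theI)

text \<open>The library norm on the type \<open>real^'n^'m\<close> is the Frobenius norm (not the operator norm).\<close>

abbreviation frobenius_norm :: "real^'n^'m \<Rightarrow> real" where
  "frobenius_norm A \<equiv> norm A"

lemma frobenius_norm_eq: "frobenius_norm A = sqrt (\<Sum>i\<in>UNIV. \<Sum>j\<in>UNIV. (A $ i $ j)\<^sup>2)"
  by (simp add: norm_vec_def L2_set_def sum_nonneg)

text \<open>With unit singular vectors on both sides, 0 is a singular value iff the null spaces of \<open>A\<close> and
  of its transpose are both nontrivial, i.e. iff the rank of \<open>A\<close> is less than both dimensions.
  The sets below are finite, and nonempty for \<open>A \<noteq> 0\<close>.\<close>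

definition is_singular_value :: "real^'n^'m \<Rightarrow> real \<Rightarrow> bool" where
  "is_singular_value A s \<longleftrightarrow> s \<ge> 0 \<and>
     (\<exists>u v. norm u = 1 \<and> norm v = 1 \<and> A *v v = s *\<^sub>R u \<and> transpose A *v u = s *\<^sub>R v)"

definition sigma_max :: "real^'n^'m \<Rightarrow> real" where
  "sigma_max A = Max {s. is_singular_value A s}"

definition sigma_min :: "real^'n^'m \<Rightarrow> real" where
  "sigma_min A = Min {s. is_singular_value A s \<and> s \<noteq> 0}"

lemma finite_singular_values:
  fixes A :: "real^'n^'m"
  shows "finite {s. is_singular_value A s}"
proof -
  let ?S = "{s. is_singular_value A s}"
  have "\<exists>v. s \<ge> 0 \<and> norm v = 1 \<and> transpose A *v (A *v v) = s\<^sup>2 *\<^sub>R v" if "s \<in> ?S" for s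
  proof -
    obtain u v where "s \<ge> 0" "norm v = 1" "A *v v = s *\<^sub>R u" "transpose A *v u = s *\<^sub>R v"
      using \<open>s \<in> ?S\<close> by (auto simp: is_singular_value_def)
    then show ?thesis
      by (intro exI[of _ v]) (simp add: matrix_vector_mult_scaleR power2_eq_square)
  qed
  then obtain v where v: "\<And>s. s \<in> ?S \<Longrightarrow>
      s \<ge> 0 \<and> norm (v s) = 1 \<and> transpose A *v (A *v v s) = s\<^sup>2 *\<^sub>R v s" by metis
  have orth: "orthogonal (v s) (v t)" if "s \<in> ?S" "t \<in> ?S" "s \<noteq> t" for s t
  proof -
    have "(transpose A *v (A *v v s)) \<bullet> v t = v s \<bullet> (transpose A *v (A *v v t))"
      by (metis inner_transpose inner_commute)
    then have "s\<^sup>2 * (v s \<bullet> v t) = t\<^sup>2 * (v s \<bullet> v t)" using v[OF that(1)] v[OF that(2)] by simp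
    moreover have "s\<^sup>2 \<noteq> t\<^sup>2" using v[OF that(1)] v[OF that(2)] that(3) by auto
    ultimately show ?thesis by (simp add: orthogonal_def)
  qed
  have inj: "inj_on v ?S"
  proof (rule inj_onI, rule ccontr)
    fix s t assume st: "s \<in> ?S" "t \<in> ?S" "v s = v t" "s \<noteq> t"
    then have "v t = 0" using orth[OF st(1,2,4)] by (simp add: orthogonal_def)
    then show False using v[OF st(2)] by simp
  qed
  have "pairwise orthogonal (v ` ?S)" using orth by (auto simp: pairwise_def)
  then have "finite (v ` ?S)" by (rule pairwise_orthogonal_imp_finite)
  then show ?thesis using inj by (rule finite_imageD)
qed

lemma nonzero_singular_value_exists:
  fixes A :: "real^'n^'m"
  assumes "A \<noteq> 0"
  shows "\<exists>s. is_singular_value A s \<and> s \<noteq> 0"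
proof -
  have "\<exists>v\<in>sphere 0 1. \<forall>w\<in>sphere 0 1. norm (A *v w) \<le> norm (A *v v)"
    by (rule continuous_attains_sup)
       (auto intro!: continuous_on_norm matrix_vector_mult_linear_continuous_on)
  then obtain v where v: "norm v = 1" "\<And>w. norm w = 1 \<Longrightarrow> norm (A *v w) \<le> norm (A *v v)"
    by (auto simp: dist_norm)
  define s where "s = norm (A *v v)"
  have bound: "norm (A *v w) \<le> s * norm w" for w
  proof (cases "w = 0")
    case False
    then have "norm (A *v ((1 / norm w) *\<^sub>R w)) \<le> s" unfolding s_def by (intro v(2)) simp
    then show ?thesis using False by (simp add: matrix_vector_mult_scaleR divide_simps)
  qed simp
  have "s \<noteq> 0"
  proof
    assume "s = 0"
    then have "A *v w = 0 *v w" for w using bound[of w] by simp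
    then show False using assms by (simp add: matrix_eq)
  qed
  then have s: "s > 0" by (simp add: s_def)
  have B: "s\<^sup>2 * (v \<bullet> w) = (A *v v) \<bullet> (A *v w)" for w
  proof -
    let ?b = "s\<^sup>2 * (v \<bullet> w) - (A *v v) \<bullet> (A *v w)"
    let ?q = "s\<^sup>2 * (w \<bullet> w) - (A *v w) \<bullet> (A *v w)"
    have q: "0 \<le> 2 * t * ?b + t\<^sup>2 * ?q" for t
    proof -
      have "(A *v (v + t *\<^sub>R w)) \<bullet> (A *v (v + t *\<^sub>R w))
          \<le> s\<^sup>2 * ((v + t *\<^sub>R w) \<bullet> (v + t *\<^sub>R w))"
        using power_mono[OF bound[of "v + t *\<^sub>R w"], of 2]
        by (simp only: power_mult_distrib power2_norm_eq_inner norm_ge_zero)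
      moreover have "(A *v v) \<bullet> (A *v v) = s\<^sup>2" "v \<bullet> v = 1"
        using v(1) by (auto simp: s_def dot_square_norm)
      ultimately show ?thesis
        by (simp add: matrix_vector_right_distrib matrix_vector_mult_scaleR inner_add
            inner_commute algebra_simps power2_eq_square)
    qed
    have q0: "?q \<ge> 0" using power_mono[OF bound[of w], of 2]
      by (simp add: power_mult_distrib power2_norm_eq_inner)
    have "?b = 0"
    proof (rule ccontr)
      assume b: "?b \<noteq> 0"
      define t where "t = - ?b / (?q + 1)"
      have "2 * t * ?b + t\<^sup>2 * ?q = - (?b\<^sup>2 * (?q + 2)) / (?q + 1)\<^sup>2"
        using q0 unfolding t_def by (simp add: divide_simps) algebra
      also have "\<dots> < 0" using b q0 by (intro divide_neg_pos) auto
      finally show False using q[of t] by simp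
    qed
    then show ?thesis by simp
  qed
  have "transpose A *v (A *v v) = s\<^sup>2 *\<^sub>R v"
  proof (rule vector_eq_rdot[THEN iffD1], rule allI)
    fix w show "(transpose A *v (A *v v)) \<bullet> w = (s\<^sup>2 *\<^sub>R v) \<bullet> w"
      using B[of w] by (simp only: inner_transpose inner_scaleR_left)
  qed
  then have "is_singular_value A s"
    unfolding is_singular_value_def using s v(1)
    by (intro conjI exI[of _ "(1 / s) *\<^sub>R (A *v v)"] exI[of _ v])
       (auto simp: s_def[symmetric] matrix_vector_mult_scaleR power2_eq_square)
  then show ?thesis using s by auto
qed

text \<open>Here \<open>idx k\<close> is the row index used in step \<open>k\<close>, for \<open>k \<ge> 1\<close>; the value \<open>idx 0\<close> is
  never used. A zero row leaves the iterate unchanged, but it is drawn with probability 0.\<close>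

primrec rk_iterate :: "real^'n^'m \<Rightarrow> real^'m \<Rightarrow> real^'n \<Rightarrow> (nat \<Rightarrow> 'm) \<Rightarrow> nat \<Rightarrow> real^'n" where
  "rk_iterate A b x0 idx 0 = x0"
| "rk_iterate A b x0 idx (Suc k) =
     (let x = rk_iterate A b x0 idx k; i = idx (Suc k); a = row i A
      in x - ((a \<bullet> x - b $ i) / (norm a)\<^sup>2) *\<^sub>R a)"

definition rk_sampling :: "real^'n^'m \<Rightarrow> 'w measure \<Rightarrow> (nat \<Rightarrow> 'w \<Rightarrow> 'm) \<Rightarrow> bool" where
  "rk_sampling A M I \<longleftrightarrow>
     prob_space M \<and>
     prob_space.indep_vars M (\<lambda>_. count_space UNIV) I {1..} \<and>
     (\<forall>k\<ge>1. \<forall>i. measure M {\<omega> \<in> space M. I k \<omega> = i} =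
        (norm (row i A))\<^sup>2 / (frobenius_norm A)\<^sup>2)"

end

theory Submission
  imports Defs
begin

text \<open>Averaged over the sampled row, a Kaczmarz step is one step of gradient descent for the
  least-squares problem: row \<open>i\<close> is drawn with a probability proportional to its squared norm, which
  cancels the normalisation in the update. Together with the normal equation for the pseudoinverse
  solution \<open>xtLS\<close> of the noisy system this shows that the expected iterate satisfies
  \<open>E x_(j+1) - xtLS = T (E x_j - xtLS)\<close> with \<open>T = I - At\<^sup>T At / \<parallel>At\<parallel>\<^sup>2\<close>, without any consistency
  of the system (\<open>mean_kaczmarz_step_error\<close>, \<open>expectation_rk_iterate\<close>). Therefore
  \<open>E x_k - xtLS = T^k (x0 - xtLS)\<close>, and measuring the error from \<open>xLS\<close> instead gives
  \<open>E x_k - xLS = T^k (x0 - xLS) - (I - T^k) (xLS - xtLS)\<close>.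

  The matrix \<open>T\<close> is symmetric and respects the orthogonal decomposition of the space into the row space
  and the null space of \<open>At\<close>. On the null space it is the identity: the error there persists, and
  \<open>I - T^k\<close> vanishes. On the row space it is diagonal in an orthonormal eigenbasis of \<open>At\<^sup>T At\<close>
  (\<open>self_adjoint_orthonormal_eigenbasis\<close>), whose eigenvalues there are squares of nonzero singular
  values (\<open>gram_eigenvalue_bounds\<close>). So the eigenvalues of \<open>T^k\<close> on the row space are at most
  \<open>\<alpha>^k\<close>, and those of \<open>I - T^k\<close> are at most \<open>\<beta>\<close> (\<open>mean_error_map_range_bounds\<close>). The triangle
  inequality combines the three contributions.\<close>

section \<open>Self-adjoint maps on invariant subspaces\<close>

text \<open>A maximiser of the Rayleigh quotient \<open>f x \<bullet> x\<close> over the unit sphere of \<open>V\<close>, which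
  exists by compactness, is an eigenvector.\<close>

lemma self_adjoint_eigenvector:
  fixes f :: "'a::euclidean_space \<Rightarrow> 'a"
  assumes lin: "linear f" and V: "subspace V" "V \<noteq> {0}"
    and inv: "\<And>x. x \<in> V \<Longrightarrow> f x \<in> V"
    and adj: "\<And>x y. x \<in> V \<Longrightarrow> y \<in> V \<Longrightarrow> f x \<bullet> y = x \<bullet> f y"
  obtains v c where "v \<in> V" "norm v = 1" "f v = c *\<^sub>R v"
proof -
  obtain w where w: "w \<in> V" "w \<noteq> 0"
    using V subspace_0[OF V(1)] by blast
  have "compact (sphere 0 1 \<inter> V)"
    using closed_subspace[OF V(1)] by (intro compact_Int_closed) auto
  moreover have "(1 / norm w) *\<^sub>R w \<in> sphere 0 1 \<inter> V"
    using w subspace_scale[OF V(1)] by simp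
  then have "sphere 0 1 \<inter> V \<noteq> {}" by blast
  moreover have "continuous_on (sphere 0 1 \<inter> V) (\<lambda>x. f x \<bullet> x)"
    by (intro continuous_on_inner continuous_on_id linear_continuous_on
        linear_conv_bounded_linear[THEN iffD1] lin)
  ultimately obtain v where v: "v \<in> V" "norm v = 1"
      and "\<forall>x\<in>sphere 0 1 \<inter> V. f x \<bullet> x \<le> f v \<bullet> v"
    using continuous_attains_sup[of "sphere 0 1 \<inter> V" "\<lambda>x. f x \<bullet> x"]
    by auto
  then have max: "f x \<bullet> x \<le> f v \<bullet> v" if "x \<in> V" "norm x = 1" for x
    using that by simp
  define c where "c = f v \<bullet> v"
  have q: "0 \<le> c * (x \<bullet> x) - f x \<bullet> x" if "x \<in> V" for x
  proof (cases "x = 0")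
    case False
    have "f ((1 / norm x) *\<^sub>R x) \<bullet> ((1 / norm x) *\<^sub>R x) \<le> c"
      unfolding c_def using that False by (intro max subspace_scale V) auto
    then show ?thesis
      using False by (simp add: linear_cmul[OF lin] dot_square_norm power2_eq_square divide_simps)
  qed (simp add: linear_0[OF lin])
  define r where "r = c *\<^sub>R v - f v"
  have r: "r \<in> V" unfolding r_def by (intro subspace_diff subspace_scale V v inv)
  have rv: "r \<bullet> v = 0" using v(2) by (simp add: r_def c_def inner_diff_left dot_square_norm)
  \<comment> \<open>The form \<open>c (x \<bullet> x) - f x \<bullet> x\<close> is nonnegative on \<open>V\<close> and vanishes at \<open>v\<close>,
    so its first variation at \<open>v\<close> in the direction \<open>- r\<close>, which is \<open>- 2 (r \<bullet> r)\<close>, must vanish.\<close>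
  have var: "0 \<le> t\<^sup>2 * (c * (r \<bullet> r) - f r \<bullet> r) - 2 * t * (r \<bullet> r)" for t
  proof -
    have "0 \<le> c * ((v - t *\<^sub>R r) \<bullet> (v - t *\<^sub>R r)) - f (v - t *\<^sub>R r) \<bullet> (v - t *\<^sub>R r)"
      by (intro q subspace_diff subspace_scale V v r)
    also have "\<dots> = (c * (v \<bullet> v) - f v \<bullet> v) + t\<^sup>2 * (c * (r \<bullet> r) - f r \<bullet> r)
        - t * (2 * c * (r \<bullet> v)) + t * (f v \<bullet> r + f r \<bullet> v)"
      by (simp add: linear_diff[OF lin] linear_cmul[OF lin] inner_diff inner_commute[of v r]
          power2_eq_square algebra_simps)
    also have "f r \<bullet> v = f v \<bullet> r"
      using adj[OF r v(1)] by (simp add: inner_commute)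
    also have "f v \<bullet> r = - (r \<bullet> r)"
      using rv by (simp add: r_def inner_diff inner_commute)
    also have "v \<bullet> v = 1" using v(2) by (simp add: dot_square_norm)
    finally show ?thesis using rv by (simp add: c_def)
  qed
  have "r \<bullet> r = 0"
  proof (rule ccontr)
    assume nz: "r \<bullet> r \<noteq> 0"
    then have pos: "r \<bullet> r > 0" by simp
    define d where "d = c * (r \<bullet> r) - f r \<bullet> r"
    have d: "d \<ge> 0" unfolding d_def using q[OF r] .
    \<comment> \<open>Small enough that the quadratic term cannot compensate for the linear one; the summand 1
      covers the case \<open>d = 0\<close>.\<close>
    define t where "t = (r \<bullet> r) / (d + 1)"
    have t: "t > 0" using pos d by (simp add: t_def)
    have "t * d \<le> r \<bullet> r" using d pos by (simp add: t_def divide_simps)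
    moreover have "0 \<le> t * (t * d - 2 * (r \<bullet> r))"
      using var[of t] unfolding d_def[symmetric] by (simp add: power2_eq_square algebra_simps)
    ultimately show False using t pos by (simp add: zero_le_mult_iff)
  qed
  then have "f v = c *\<^sub>R v" by (simp add: r_def)
  with v that show ?thesis by blast
qed

text \<open>The finite-dimensional spectral theorem on an invariant subspace: split off one eigenvector and
  continue on its orthogonal complement inside \<open>V\<close>, which is again invariant because \<open>f\<close> is
  self-adjoint.\<close>

lemma self_adjoint_orthonormal_eigenbasis:
  fixes f :: "'a::euclidean_space \<Rightarrow> 'a"
  assumes "linear f" "subspace V"
    and "\<And>x. x \<in> V \<Longrightarrow> f x \<in> V"
    and "\<And>x y. x \<in> V \<Longrightarrow> y \<in> V \<Longrightarrow> f x \<bullet> y = x \<bullet> f y"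
  shows "\<exists>B. finite B \<and> pairwise orthogonal B \<and> span B = V \<and>
      (\<forall>e\<in>B. norm e = 1 \<and> (\<exists>c. f e = c *\<^sub>R e))"
  using assms(2-4)
proof (induction "dim V" arbitrary: V rule: less_induct)
  case less
  note V = less.prems
  show ?case
  proof (cases "V = {0}")
    case True
    then show ?thesis by (intro exI[of _ "{}"]) auto
  next
    case False
    obtain v c where v: "v \<in> V" "norm v = 1" "f v = c *\<^sub>R v"
      using self_adjoint_eigenvector[OF assms(1) V(1) False V(2,3)] by blast
    define W where "W = V \<inter> {x. v \<bullet> x = 0}"
    have W: "subspace W" unfolding W_def by (intro subspace_inter V subspace_hyperplane)
    have "v \<notin> W" using v(2) by (auto simp: W_def)
    moreover have "W \<subseteq> V" by (auto simp: W_def)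
    ultimately have "W \<subset> V" using v(1) by blast
    then have "dim W < dim V"
      using W V(1) by (intro dim_psubset) (simp add: span_eq_iff[THEN iffD2])
    moreover have "f x \<in> W" if "x \<in> W" for x
    proof -
      have "v \<bullet> f x = f v \<bullet> x" using V(3)[OF v(1), of x] that by (simp add: W_def)
      then show ?thesis using that V(2) v(3) by (simp add: W_def)
    qed
    ultimately obtain B where B: "finite B" "pairwise orthogonal B" "span B = W"
        "\<forall>e\<in>B. norm e = 1 \<and> (\<exists>c. f e = c *\<^sub>R e)"
      using less.hyps[of W] W V(3) unfolding W_def by (metis IntD1)
    have BW: "B \<subseteq> W" using B(3) span_superset by blast
    have "pairwise orthogonal (insert v B)"
      using B(2) BW by (auto simp: pairwise_insert W_def orthogonal_def inner_commute)
    moreover have "span (insert v B) = V"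
    proof
      show "span (insert v B) \<subseteq> V"
        using BW v(1) V(1) by (intro span_minimal) (auto simp: W_def)
      show "V \<subseteq> span (insert v B)"
      proof
        fix x assume x: "x \<in> V"
        have "x - (v \<bullet> x) *\<^sub>R v \<in> W"
          using x v V(1) by (auto simp: W_def subspace_diff subspace_scale inner_diff_right dot_square_norm)
        then show "x \<in> span (insert v B)" unfolding span_insert B(3) by blast
      qed
    qed
    moreover have "\<forall>e\<in>insert v B. norm e = 1 \<and> (\<exists>c. f e = c *\<^sub>R e)"
      using B(4) v by blast
    ultimately show ?thesis using B(1) by (intro exI[of _ "insert v B"] conjI) simp_all
  qed
qed

text \<open>By Pythagoras, the operator norm of a map that is diagonal in an orthonormal basis is bounded by
  its largest diagonal entry in modulus.\<close>

lemma norm_le_of_diagonal: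
  fixes g :: "'a::euclidean_space \<Rightarrow> 'a"
  assumes lin: "linear g" and B: "finite B" "pairwise orthogonal B" "\<And>e. e \<in> B \<Longrightarrow> norm e = 1"
    and diag: "\<And>e. e \<in> B \<Longrightarrow> \<exists>\<mu>. g e = \<mu> *\<^sub>R e \<and> \<bar>\<mu>\<bar> \<le> c" and c: "c \<ge> 0"
    and x: "x \<in> span B"
  shows "norm (g x) \<le> c * norm x"
proof -
  have ex: "(\<Sum>e\<in>B. (x \<bullet> e) *\<^sub>R e) = x"
    by (rule orthonormal_basis_expand[OF B(2,3) x B(1)])
  obtain \<mu> where \<mu>: "\<And>e. e \<in> B \<Longrightarrow> g e = \<mu> e *\<^sub>R e" "\<And>e. e \<in> B \<Longrightarrow> \<bar>\<mu> e\<bar> \<le> c"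
    using diag by metis
  have pyth: "(norm (\<Sum>e\<in>B. a e *\<^sub>R e))\<^sup>2 = (\<Sum>e\<in>B. (a e)\<^sup>2)" for a
    using B by (subst norm_sum_Pythagorean)
      (auto simp: pairwise_def orthogonal_def power_mult_distrib)
  have "g x = g (\<Sum>e\<in>B. (x \<bullet> e) *\<^sub>R e)" by (simp only: ex)
  also have "\<dots> = (\<Sum>e\<in>B. (\<mu> e * (x \<bullet> e)) *\<^sub>R e)"
    by (auto simp: linear_sum[OF lin] linear_cmul[OF lin] \<mu>(1) mult.commute intro!: sum.cong)
  finally have "(norm (g x))\<^sup>2 = (\<Sum>e\<in>B. (\<mu> e * (x \<bullet> e))\<^sup>2)" by (simp only: pyth)
  also have "\<dots> \<le> (\<Sum>e\<in>B. c\<^sup>2 * (x \<bullet> e)\<^sup>2)"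
  proof (rule sum_mono)
    fix e assume "e \<in> B"
    then have "(\<mu> e)\<^sup>2 \<le> c\<^sup>2" using \<mu>(2)[of e] c by (simp add: abs_le_square_iff[symmetric])
    then show "(\<mu> e * (x \<bullet> e))\<^sup>2 \<le> c\<^sup>2 * (x \<bullet> e)\<^sup>2"
      by (simp add: power_mult_distrib mult_right_mono)
  qed
  also have "\<dots> = (c * norm x)\<^sup>2"
    using pyth[of "\<lambda>e. x \<bullet> e"] by (simp add: ex sum_distrib_left power_mult_distrib)
  finally show ?thesis using c by (simp add: power2_le_iff_abs_le)
qed

section \<open>Singular values and eigenvalues of the Gram matrix\<close>

text \<open>Cauchy--Schwarz in each row. This keeps all squared singular values below the squared Frobenius
  norm, so that the contraction factors below lie in \<open>[0, 1]\<close>.\<close>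

lemma norm_matrix_vector_le_frobenius:
  fixes A :: "real^'n^'m"
  shows "norm (A *v x) \<le> frobenius_norm A * norm x"
proof -
  have "norm (A *v x) \<le> L2_set (\<lambda>i. norm (A $ i) * norm x) UNIV"
    unfolding norm_vec_def[of "A *v x"]
    by (intro L2_set_mono) (auto simp: matrix_vector_mul_component Cauchy_Schwarz_ineq2)
  also have "\<dots> = frobenius_norm A * norm x"
    by (simp add: L2_set_left_distrib norm_vec_def[of A])
  finally show ?thesis .
qed

lemma singular_value_le_frobenius:
  assumes "is_singular_value A s"
  shows "s \<le> frobenius_norm A"
proof -
  obtain u v where "s \<ge> 0" "norm u = 1" "norm v = 1" "A *v v = s *\<^sub>R u"
    using assms by (auto simp: is_singular_value_def)
  then show ?thesis using norm_matrix_vector_le_frobenius[of A v] by simp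
qed

text \<open>If \<open>e\<close> is a unit eigenvector of the Gram matrix, then \<open>c\<close> is the squared norm of \<open>A *v e\<close>, and
  \<open>A *v e\<close> scaled to norm 1 is the left singular vector belonging to \<open>e\<close>.\<close>

lemma singular_value_of_gram_eigenvector:
  fixes A :: "real^'n^'m"
  assumes e: "norm e = 1" "transpose A *v (A *v e) = c *\<^sub>R e" and c: "c \<noteq> 0"
  shows "c > 0" "is_singular_value A (sqrt c)"
proof -
  have "c = (transpose A *v (A *v e)) \<bullet> e" using e by (simp add: dot_square_norm)
  also have "\<dots> = (norm (A *v e))\<^sup>2" by (simp only: inner_transpose dot_square_norm)
  finally have ceq: "c = (norm (A *v e))\<^sup>2" .
  then show pos: "c > 0" using c by (metis zero_less_power2 power_zero_numeral)
  have n: "norm (A *v e) = sqrt c" by (simp add: ceq)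
  have sq: "inverse (sqrt c) * c = sqrt c" using pos by (simp add: divide_simps real_div_sqrt)
  show "is_singular_value A (sqrt c)"
    unfolding is_singular_value_def using pos e n
    by (intro conjI exI[of _ "inverse (sqrt c) *\<^sub>R (A *v e)"] exI[of _ e])
       (auto simp: matrix_vector_mult_scaleR sq)
qed

lemma sigma_max_singular: "A \<noteq> 0 \<Longrightarrow> is_singular_value A (sigma_max A)"
  using Max_in[OF finite_singular_values[of A]] nonzero_singular_value_exists[of A]
  by (auto simp: sigma_max_def)

lemma sigma_min_singular:
  assumes "A \<noteq> 0"
  shows "is_singular_value A (sigma_min A)"
proof -
  have "finite {s. is_singular_value A s \<and> s \<noteq> 0}"
    by (rule finite_subset[OF _ finite_singular_values[of A]]) auto
  then show ?thesis
    using Min_in[of "{s. is_singular_value A s \<and> s \<noteq> 0}"] nonzero_singular_value_exists[OF assms]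
    by (auto simp: sigma_min_def)
qed

text \<open>The row space meets the null space only in 0, so an eigenvector in the row space has a nonzero
  eigenvalue, which is then the square of a nonzero singular value. This is where the smallest
  \<^emph>\<open>nonzero\<close> singular value enters.\<close>

lemma gram_eigenvalue_bounds:
  fixes A :: "real^'n^'m"
  assumes e: "norm e = 1" "transpose A *v (A *v e) = c *\<^sub>R e" "e \<in> matrix_range (transpose A)"
  shows "(sigma_min A)\<^sup>2 \<le> c" "c \<le> (sigma_max A)\<^sup>2"
proof -
  have "c \<noteq> 0"
  proof
    assume "c = 0"
    obtain y where y: "e = transpose A *v y" using e(3) by (auto simp: matrix_range_def)
    have "(A *v e) \<bullet> (A *v e) = (transpose A *v (A *v e)) \<bullet> e" by (simp only: inner_transpose)
    then have "A *v e = 0" using e(2) \<open>c = 0\<close> by simp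
    then have "e \<bullet> e = 0" using inner_transpose[of A y e] y by simp
    then show False using e(1) by simp
  qed
  note c = singular_value_of_gram_eigenvector[OF e(1,2) this]
  have fin: "finite {s. is_singular_value A s}" by (rule finite_singular_values)
  have "sigma_min A \<le> sqrt c" unfolding sigma_min_def
    by (rule Min_le) (use c fin in \<open>auto intro: finite_subset[OF _ fin]\<close>)
  moreover have "A \<noteq> 0" using e(2) c(1) e(1) by auto
  then have "sigma_min A \<ge> 0" using sigma_min_singular by (auto simp: is_singular_value_def)
  ultimately show "(sigma_min A)\<^sup>2 \<le> c"
    using c(1) power_mono[of "sigma_min A" "sqrt c" 2] by simp
  have "sqrt c \<le> sigma_max A" unfolding sigma_max_def
    by (rule Max_ge) (use c fin in auto)
  then show "c \<le> (sigma_max A)\<^sup>2"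
    using c(1) power_mono[of "sqrt c" "sigma_max A" 2] by simp
qed

section \<open>Row space, null space and the normal equation\<close>

lemma orthogonal_to_range_transpose:
  fixes A :: "real^'n^'m"
  assumes "\<And>v. v \<in> matrix_range (transpose A) \<Longrightarrow> orthogonal x v"
  shows "A *v x = 0"
proof -
  have "orthogonal x (transpose A *v (A *v x))" 
    by (rule assms) (simp add: matrix_range_def)
  then show ?thesis
    using inner_transpose[of A "A *v x" x] by (simp add: orthogonal_def inner_commute)
qed

lemma subspace_matrix_null: "subspace (matrix_null A)"
  unfolding matrix_null_def by (rule linear_subspace_kernel) (rule matrix_vector_mul_linear)

text \<open>The null space is the orthogonal complement of the row space, so the two projections add up to
  the identity.\<close>

lemma range_null_decomposition:
  fixes A :: "real^'n^'m"
  shows "orth_proj (matrix_range (transpose A)) x + orth_proj (matrix_null A) x = x"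
proof -
  let ?R = "matrix_range (transpose A)"
  note p = orth_proj_props[OF subspace_matrix_range[of "transpose A"]]
  have "orth_proj (matrix_null A) x = x - orth_proj ?R x"
  proof (rule orth_proj_eqI[OF subspace_matrix_null])
    show "x - orth_proj ?R x \<in> matrix_null A"
      unfolding matrix_null_def mem_Collect_eq
      by (rule orthogonal_to_range_transpose) (rule p(2))
    fix v assume "v \<in> matrix_null A"
    moreover obtain y where "orth_proj ?R x = transpose A *v y"
      using p(1)[of x] by (auto simp: matrix_range_def)
    ultimately show "orthogonal (x - (x - orth_proj ?R x)) v"
      using inner_transpose[of A y v] by (simp add: orthogonal_def matrix_null_def)
  qed
  then show ?thesis by simp
qed

text \<open>The pseudoinverse solution solves the normal equation, since by the Penrose equations
  \<open>A ** pinv A\<close> is symmetric and fixes \<open>A\<close> from the left.\<close>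

lemma normal_equation_pinv:
  fixes A :: "real^'n^'m"
  shows "transpose A *v (A *v (pinv A *v b)) = transpose A *v b"
proof -
  have P: "transpose (A ** pinv A) = A ** pinv A" "A ** pinv A ** A = A"
    using is_pinv_pinv[of A] by (simp_all add: is_pinv_def)
  have "transpose A ** (A ** pinv A) = transpose ((A ** pinv A) ** A)"
    by (subst matrix_transpose_mul) (simp only: P(1))
  then show ?thesis unfolding P(2) by (simp only: matrix_vector_mul_assoc matrix_mul_assoc)
qed

section \<open>Powers of the averaged error map\<close>

text \<open>The map by which one Kaczmarz step acts, on average, on the difference between the iterate and
  the least-squares solution, see \<open>mean_kaczmarz_step_error\<close>. Its eigenvalues are
  \<open>1 - c / (frobenius_norm A)\<^sup>2\<close>, where \<open>c\<close> runs through the eigenvalues of the Gram matrix.\<close>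

definition mean_error_map :: "real^'n^'m \<Rightarrow> real^'n \<Rightarrow> real^'n" where
  "mean_error_map A x = x - (1 / (frobenius_norm A)\<^sup>2) *\<^sub>R (transpose A *v (A *v x))"

lemma linear_mean_error_map: "linear (mean_error_map A)"
  by (rule linearI)
     (simp_all add: mean_error_map_def matrix_vector_right_distrib matrix_vector_mult_scaleR
       scaleR_add_right scaleR_diff_right)

lemma linear_mean_error_map_funpow: "linear (mean_error_map A ^^ k)"
proof (induction k)
  case 0
  then show ?case by (simp add: linear_ident)
next
  case (Suc k)
  then show ?case using linear_compose[OF Suc linear_mean_error_map] by (simp add: o_def)
qed

lemma mean_error_map_funpow_eigenvector:
  assumes "transpose A *v (A *v e) = c *\<^sub>R e"
  shows "(mean_error_map A ^^ k) e = (1 - c / (frobenius_norm A)\<^sup>2) ^ k *\<^sub>R e"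
proof (induction k)
  case (Suc k)
  have "mean_error_map A e = (1 - c / (frobenius_norm A)\<^sup>2) *\<^sub>R e"
    using assms by (simp add: mean_error_map_def scaleR_diff_left)
  then show ?case using Suc by (simp add: linear_cmul[OF linear_mean_error_map])
qed simp

lemma mean_error_map_funpow_null:
  assumes "x \<in> matrix_null A"
  shows "(mean_error_map A ^^ k) x = x"
  using mean_error_map_funpow_eigenvector[of A x 0 k] assms by (simp add: matrix_null_def)

text \<open>On an eigenbasis of the row space, \<open>mean_error_map\<close> has diagonal entries between
  \<open>1 - (sigma_max A)\<^sup>2 / (frobenius_norm A)\<^sup>2 \<ge> 0\<close> and \<open>1 - (sigma_min A)\<^sup>2 / (frobenius_norm A)\<^sup>2\<close>.
  The \<open>k\<close>-th power is therefore controlled by the upper end of this interval, and the difference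
  between the identity and the \<open>k\<close>-th power by the lower end.\<close>

lemma mean_error_map_range_bounds:
  fixes A :: "real^'n^'m"
  assumes A: "A \<noteq> 0" and x: "x \<in> matrix_range (transpose A)"
  shows "norm ((mean_error_map A ^^ k) x)
      \<le> (1 - (sigma_min A)\<^sup>2 / (frobenius_norm A)\<^sup>2) ^ k * norm x"
    and "norm (x - (mean_error_map A ^^ k) x)
      \<le> (1 - (1 - (sigma_max A)\<^sup>2 / (frobenius_norm A)\<^sup>2) ^ k) * norm x"
proof -
  let ?R = "matrix_range (transpose A)"
  let ?F = "(frobenius_norm A)\<^sup>2"
  let ?\<alpha> = "1 - (sigma_min A)\<^sup>2 / ?F" and ?\<gamma> = "1 - (sigma_max A)\<^sup>2 / ?F"
  have F: "?F > 0" using A by simp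
  have le_F: "s\<^sup>2 / ?F \<le> 1" if "is_singular_value A s" for s
    using that singular_value_le_frobenius[OF that] F
    by (auto simp: is_singular_value_def divide_le_eq intro: power_mono)
  have \<alpha>: "?\<alpha> \<ge> 0" using le_F[OF sigma_min_singular[OF A]] by simp
  have \<gamma>: "?\<gamma> \<ge> 0" "?\<gamma> \<le> 1" using le_F[OF sigma_max_singular[OF A]] F by auto
  have lin: "linear (\<lambda>x. transpose A *v (A *v x))"
    by (simp add: matrix_vector_mul_assoc matrix_vector_mul_linear)
  obtain B where B: "finite B" "pairwise orthogonal B" "span B = ?R"
      "\<forall>e\<in>B. norm e = 1 \<and> (\<exists>c. transpose A *v (A *v e) = c *\<^sub>R e)"
  proof -
    have "(transpose A *v (A *v x)) \<bullet> y = x \<bullet> (transpose A *v (A *v y))" for x y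
      by (metis inner_transpose inner_commute)
    moreover have "transpose A *v (A *v x) \<in> ?R" for x
      unfolding matrix_range_def by (rule rangeI)
    ultimately have "\<exists>B. finite B \<and> pairwise orthogonal B \<and> span B = ?R \<and>
        (\<forall>e\<in>B. norm e = 1 \<and> (\<exists>c. transpose A *v (A *v e) = c *\<^sub>R e))"
      by (intro self_adjoint_orthonormal_eigenbasis lin subspace_matrix_range)
    then show thesis using that by blast
  qed
  have eig: "\<exists>\<mu>::real. (mean_error_map A ^^ k) e = \<mu> ^ k *\<^sub>R e \<and> ?\<gamma> \<le> \<mu> \<and> \<mu> \<le> ?\<alpha>"
    if e: "e \<in> B" for e
  proof -
    obtain c where c: "norm e = 1" "transpose A *v (A *v e) = c *\<^sub>R e" using B(4) e by blast
    have "e \<in> ?R" using e B(3) span_base by blast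
    from gram_eigenvalue_bounds[OF c this]
    have "?\<gamma> \<le> 1 - c / ?F" "1 - c / ?F \<le> ?\<alpha>"
      by (simp_all add: divide_right_mono)
    then show ?thesis
      by (intro exI[of _ "1 - c / ?F"] conjI mean_error_map_funpow_eigenvector c)
  qed
  show "norm ((mean_error_map A ^^ k) x) \<le> ?\<alpha> ^ k * norm x"
  proof (rule norm_le_of_diagonal[OF linear_mean_error_map_funpow B(1,2)])
    fix e assume "e \<in> B"
    from eig[OF this] obtain \<mu> :: real where "(mean_error_map A ^^ k) e = \<mu> ^ k *\<^sub>R e" "?\<gamma> \<le> \<mu>" "\<mu> \<le> ?\<alpha>"
      by blast
    then show "\<exists>\<mu>. (mean_error_map A ^^ k) e = \<mu> *\<^sub>R e \<and> \<bar>\<mu>\<bar> \<le> ?\<alpha> ^ k"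
      using \<gamma>(1) power_mono[of \<mu> ?\<alpha> k] by (intro exI[of _ "\<mu> ^ k"]) (simp add: power_abs)
  qed (use B \<alpha> x in auto)
  show "norm (x - (mean_error_map A ^^ k) x) \<le> (1 - ?\<gamma> ^ k) * norm x"
  proof (rule norm_le_of_diagonal[OF _ B(1,2)])
    show "linear (\<lambda>x. x - (mean_error_map A ^^ k) x)"
      by (intro linear_compose_sub linear_ident linear_mean_error_map_funpow)
    fix e assume "e \<in> B"
    from eig[OF this] obtain \<mu> :: real where \<mu>: "(mean_error_map A ^^ k) e = \<mu> ^ k *\<^sub>R e" "?\<gamma> \<le> \<mu>" "\<mu> \<le> ?\<alpha>"
      by blast
    moreover have "?\<gamma> ^ k \<le> \<mu> ^ k" using \<mu>(2) \<gamma>(1) by (rule power_mono)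
    moreover have "\<mu> \<le> 1" using \<mu>(3) F by (smt (verit) divide_nonneg_pos zero_le_power2)
    then have "\<mu> ^ k \<le> 1" using \<mu>(2) \<gamma>(1) by (intro power_le_one) auto
    ultimately show "\<exists>\<mu>. e - (mean_error_map A ^^ k) e = \<mu> *\<^sub>R e \<and> \<bar>\<mu>\<bar> \<le> 1 - ?\<gamma> ^ k"
      by (intro exI[of _ "1 - \<mu> ^ k"]) (simp add: scaleR_diff_left)
  qed (use B \<gamma> x in \<open>auto intro: power_le_one\<close>)
qed

section \<open>The averaged Kaczmarz step\<close>

definition kaczmarz_step :: "real^'n^'m \<Rightarrow> real^'m \<Rightarrow> 'm \<Rightarrow> real^'n \<Rightarrow> real^'n" where
  "kaczmarz_step A b i x =
     x - ((row i A \<bullet> x - b $ i) / (norm (row i A))\<^sup>2) *\<^sub>R row i A"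

lemma rk_iterate_Suc:
  "rk_iterate A b x0 idx (Suc k) = kaczmarz_step A b (idx (Suc k)) (rk_iterate A b x0 idx k)"
  by (simp add: kaczmarz_step_def Let_def)

lemma sum_norm_rows: "(\<Sum>i\<in>UNIV. (norm (row i A))\<^sup>2) = (frobenius_norm A)\<^sup>2"
  for A :: "real^'n^'m"
  by (simp add: norm_vec_def[of A] L2_set_def sum_nonneg row_def vec_nth_inverse)

text \<open>The sampling weights cancel the normalisation of the step, so the average step is a gradient
  step for the least-squares functional.\<close>

lemma mean_kaczmarz_step:
  fixes A :: "real^'n^'m"
  assumes "A \<noteq> 0"
  shows "(\<Sum>i\<in>UNIV. ((norm (row i A))\<^sup>2 / (frobenius_norm A)\<^sup>2) *\<^sub>R kaczmarz_step A b i x)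
    = x - (1 / (frobenius_norm A)\<^sup>2) *\<^sub>R (transpose A *v (A *v x - b))"
proof -
  let ?F = "(frobenius_norm A)\<^sup>2"
  have F: "?F \<noteq> 0" using assms by simp
  have "((norm (row i A))\<^sup>2 / ?F) *\<^sub>R kaczmarz_step A b i x
      = ((norm (row i A))\<^sup>2 / ?F) *\<^sub>R x - (1 / ?F) *\<^sub>R ((A *v x - b) $ i *\<^sub>R row i A)" for i
  \<comment> \<open>A zero row has sampling weight 0 and contributes nothing to the right-hand side either.\<close>
  proof (cases "row i A = 0")
    case False
    have "(A *v x) $ i = row i A \<bullet> x" by (simp add: matrix_vector_mul_component row_def vec_nth_inverse)
    then show ?thesis using False by (simp add: kaczmarz_step_def scaleR_diff_right)
  qed simp
  then have "(\<Sum>i\<in>UNIV. ((norm (row i A))\<^sup>2 / ?F) *\<^sub>R kaczmarz_step A b i x)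
      = ((\<Sum>i\<in>UNIV. (norm (row i A))\<^sup>2) / ?F) *\<^sub>R x
        - (1 / ?F) *\<^sub>R (\<Sum>i\<in>UNIV. (A *v x - b) $ i *\<^sub>R row i A)"
    by (simp only: sum_subtractf scaleR_sum_left[symmetric] scaleR_sum_right[symmetric]
        sum_divide_distrib)
  also have "(\<Sum>i\<in>UNIV. (A *v x - b) $ i *\<^sub>R row i A) = transpose A *v (A *v x - b)"
    unfolding matrix_mult_sum[of "transpose A"] by (simp add: scalar_mult_eq_scaleR)
  finally show ?thesis using F by (simp add: sum_norm_rows)
qed

text \<open>By the normal equation the residual \<open>A *v x - b\<close> may be replaced by \<open>A *v (x - pinv A *v b)\<close>, even
  if the system is inconsistent: \<open>transpose A\<close> annihilates the difference.\<close>

lemma mean_kaczmarz_step_error: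
  fixes A :: "real^'n^'m"
  assumes "A \<noteq> 0"
  shows "(\<Sum>i\<in>UNIV. ((norm (row i A))\<^sup>2 / (frobenius_norm A)\<^sup>2) *\<^sub>R kaczmarz_step A b i x)
      - pinv A *v b = mean_error_map A (x - pinv A *v b)"
proof -
  have "transpose A *v (A *v x - b) = transpose A *v (A *v (x - pinv A *v b))"
    by (simp only: matrix_vector_mult_diff_distrib normal_equation_pinv)
  then show ?thesis
    unfolding mean_kaczmarz_step[OF assms] mean_error_map_def by simp
qed

section \<open>The expected iterate\<close>

text \<open>The first \<open>k\<close> iterates depend on the indices \<open>1, \<dots>, k\<close> only; under independent sampling
  they are therefore independent of the index drawn in step \<open>Suc k\<close>.\<close>

lemma rk_iterate_restrict:
  "j \<le> k \<Longrightarrow> rk_iterate A b x0 (restrict idx {1..k}) j = rk_iterate A b x0 idx j"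
  by (induction j) (simp_all add: rk_iterate_Suc del: rk_iterate.simps(2))

lemma measurable_kaczmarz_step: "kaczmarz_step A b i \<in> borel_measurable borel"
  unfolding kaczmarz_step_def by measurable

lemma measurable_rk_iterate:
  fixes A :: "real^'n^'m"
  assumes idx: "\<And>j. 1 \<le> j \<Longrightarrow> j \<le> k \<Longrightarrow> (\<lambda>\<omega>. idx \<omega> j) \<in> measurable N (count_space UNIV)"
  shows "(\<lambda>\<omega>. rk_iterate A b x0 (idx \<omega>) k) \<in> borel_measurable N"
  using assms
proof (induction k)
  case (Suc k)
  then have [measurable]: "(\<lambda>\<omega>. rk_iterate A b x0 (idx \<omega>) k) \<in> borel_measurable N" by simp
  show ?case unfolding rk_iterate_Suc
  proof (rule measurable_compose_countable'[where I=UNIV and g="\<lambda>\<omega>. idx \<omega> (Suc k)"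
        and f="\<lambda>i \<omega>. kaczmarz_step A b i (rk_iterate A b x0 (idx \<omega>) k)"])
    show "(\<lambda>\<omega>. kaczmarz_step A b i (rk_iterate A b x0 (idx \<omega>) k)) \<in> borel_measurable N" for i
      by (rule measurable_compose[OF _ measurable_kaczmarz_step]) simp
  qed (use Suc.prems in \<open>auto intro: countable_finite\<close>)
qed simp

text \<open>The product rule for independent real random variables, applied to each component \<open>X \<bullet> z\<close>.\<close>

lemma (in prob_space) expectation_scaleR_indep:
  fixes X :: "'a \<Rightarrow> 'b::euclidean_space" and W :: "'a \<Rightarrow> real"
  assumes X: "integrable M X" and W: "integrable M W"
    and WX: "integrable M (\<lambda>\<omega>. W \<omega> *\<^sub>R X \<omega>)"
    and ind: "\<And>z. indep_var borel (\<lambda>\<omega>. X \<omega> \<bullet> z) borel W"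
  shows "expectation (\<lambda>\<omega>. W \<omega> *\<^sub>R X \<omega>) = expectation W *\<^sub>R expectation X"
proof (rule vector_eq_rdot[THEN iffD1], rule allI)
  fix z
  have "expectation (\<lambda>\<omega>. W \<omega> *\<^sub>R X \<omega>) \<bullet> z = expectation (\<lambda>\<omega>. (W \<omega> *\<^sub>R X \<omega>) \<bullet> z)"
    by (rule integral_inner_left[symmetric]) (rule WX)
  also have "\<dots> = expectation (\<lambda>\<omega>. (X \<omega> \<bullet> z) * W \<omega>)"
    by (simp only: inner_scaleR_left mult.commute)
  also have "\<dots> = expectation (\<lambda>\<omega>. X \<omega> \<bullet> z) * expectation W"
    using X W by (intro indep_var_lebesgue_integral ind) auto
  finally show "expectation (\<lambda>\<omega>. W \<omega> *\<^sub>R X \<omega>) \<bullet> z = (expectation W *\<^sub>R expectation X) \<bullet> z"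
    using X by (simp add: mult.commute)
qed

text \<open>A Kaczmarz step is affine in the current iterate, so expectation passes through it; the next
  index is independent of the current iterate, so averaging over it produces \<open>mean_error_map\<close>.
  Integrability is carried along in the same induction.\<close>

lemma expectation_rk_iterate:
  fixes A :: "real^'n^'m" and I :: "nat \<Rightarrow> 'w \<Rightarrow> 'm"
  assumes A: "A \<noteq> 0" and rk: "rk_sampling A M I"
  shows "integrable M (\<lambda>\<omega>. rk_iterate A b x0 (\<lambda>j. I j \<omega>) k) \<and>
    (LINT \<omega>|M. rk_iterate A b x0 (\<lambda>j. I j \<omega>) k) - pinv A *v b
      = (mean_error_map A ^^ k) (x0 - pinv A *v b)"
proof (induction k)
  interpret prob_space M using rk by (simp add: rk_sampling_def)
  case 0
  show ?case by (simp add: prob_space)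
next
  interpret prob_space M using rk by (simp add: rk_sampling_def)
  have indep: "indep_vars (\<lambda>_. count_space UNIV) I {1..}"
    and p: "\<And>k i. k \<ge> 1 \<Longrightarrow>
      prob {\<omega> \<in> space M. I k \<omega> = i} = (norm (row i A))\<^sup>2 / (frobenius_norm A)\<^sup>2"
    using rk by (simp_all add: rk_sampling_def)
  case (Suc k)
  let ?C = "\<lambda>_::nat. count_space (UNIV :: 'm set)"
  let ?x = "\<lambda>\<omega>. rk_iterate A b x0 (\<lambda>j. I j \<omega>) k"
  let ?W = "\<lambda>i \<omega>. indicator {i} (I (Suc k) \<omega>) :: real"
  have x: "integrable M ?x" using Suc by blast
  have I: "I (Suc k) \<in> measurable M (count_space UNIV)"
    using indep by (auto simp: indep_vars_def)
  have W: "integrable M (?W i)" for i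
    by (rule integrable_const_bound[where B=1])
       (auto intro!: measurable_compose[OF I] simp: indicator_def)
  have W_exp: "expectation (?W i) = (norm (row i A))\<^sup>2 / (frobenius_norm A)\<^sup>2" for i
  proof -
    have "{\<omega> \<in> space M. I (Suc k) \<omega> = i} \<in> events"
      using measurable_sets[OF I, of "{i}"] by (simp add: vimage_def Int_def conj_commute)
    moreover have "expectation (?W i) = expectation (indicator {\<omega> \<in> space M. I (Suc k) \<omega> = i})"
      by (intro Bochner_Integration.integral_cong) (auto simp: indicator_def)
    ultimately show ?thesis using p[of "Suc k" i] by simp
  qed
  have indep: "indep_var (PiM {1..k} ?C) (\<lambda>\<omega>. restrict (\<lambda>j. I j \<omega>) {1..k})
      (PiM {Suc k} ?C) (\<lambda>\<omega>. restrict (\<lambda>j. I j \<omega>) {Suc k})"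
    by (rule indep_var_restrict[OF indep]) auto
  have step_int: "integrable M (\<lambda>\<omega>. kaczmarz_step A b i (?x \<omega>))"
    and step_exp: "expectation (\<lambda>\<omega>. kaczmarz_step A b i (?x \<omega>)) = kaczmarz_step A b i (expectation ?x)" for i
    using x unfolding kaczmarz_step_def by (simp_all add: prob_space)
  have step_ind: "indep_var borel (\<lambda>\<omega>. kaczmarz_step A b i (?x \<omega>) \<bullet> z) borel (?W i)" for i z
  proof -
    let ?past = "\<lambda>f. kaczmarz_step A b i (rk_iterate A b x0 f k) \<bullet> z"
    let ?hit = "\<lambda>f. indicator {i} (f (Suc k)) :: real"
    have "?past \<in> borel_measurable (PiM {1..k} ?C)"
      by (intro borel_measurable_inner measurable_compose[OF _ measurable_kaczmarz_step]
          measurable_rk_iterate measurable_const measurable_component_singleton) auto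
    moreover have "?hit \<in> borel_measurable (PiM {Suc k} ?C)"
      by (rule measurable_compose[OF measurable_component_singleton]) auto
    ultimately have "indep_var borel (?past \<circ> (\<lambda>\<omega>. restrict (\<lambda>j. I j \<omega>) {1..k}))
        borel (?hit \<circ> (\<lambda>\<omega>. restrict (\<lambda>j. I j \<omega>) {Suc k}))"
      by (rule indep_var_compose[OF indep])
    then show ?thesis by (simp add: o_def rk_iterate_restrict del: One_nat_def)
  qed
  \<comment> \<open>Sorting by the value of the new index separates it from the past.\<close>
  have eq: "rk_iterate A b x0 (\<lambda>j. I j \<omega>) (Suc k)
      = (\<Sum>i\<in>UNIV. ?W i \<omega> *\<^sub>R kaczmarz_step A b i (?x \<omega>))" for \<omega>
    unfolding rk_iterate_Suc
    by (simp add: indicator_def of_bool_def if_distrib[where f="\<lambda>c. c *\<^sub>R _"] cong: if_cong)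
  have int: "integrable M (\<lambda>\<omega>. ?W i \<omega> *\<^sub>R kaczmarz_step A b i (?x \<omega>))" for i
  proof (rule Bochner_Integration.integrable_bound[OF step_int[of i]])
    show "(\<lambda>\<omega>. ?W i \<omega> *\<^sub>R kaczmarz_step A b i (?x \<omega>)) \<in> borel_measurable M"
      by (intro borel_measurable_scaleR borel_measurable_integrable[OF W]
          borel_measurable_integrable[OF step_int])
  qed (simp add: indicator_def)
  have "expectation (\<lambda>\<omega>. rk_iterate A b x0 (\<lambda>j. I j \<omega>) (Suc k))
      = (\<Sum>i\<in>UNIV. expectation (\<lambda>\<omega>. ?W i \<omega> *\<^sub>R kaczmarz_step A b i (?x \<omega>)))"
    unfolding eq by (rule Bochner_Integration.integral_sum) (rule int)
  also have "\<dots> = (\<Sum>i\<in>UNIV. ((norm (row i A))\<^sup>2 / (frobenius_norm A)\<^sup>2) *\<^sub>R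
      kaczmarz_step A b i (expectation ?x))"
    by (simp only: expectation_scaleR_indep[OF step_int W int step_ind] W_exp step_exp)
  finally have "expectation (\<lambda>\<omega>. rk_iterate A b x0 (\<lambda>j. I j \<omega>) (Suc k)) - pinv A *v b
      = (mean_error_map A ^^ Suc k) (x0 - pinv A *v b)"
    using Suc by (simp only: mean_kaczmarz_step_error[OF A] funpow.simps o_apply)
  moreover have "integrable M (\<lambda>\<omega>. rk_iterate A b x0 (\<lambda>j. I j \<omega>) (Suc k))"
    unfolding eq by (rule Bochner_Integration.integrable_sum) (rule int)
  ultimately show ?case by blast
qed

section \<open>The error bound\<close>

theorem theorem4p2:
  fixes A At :: "real^'n^'m" and b bt :: "real^'m" and x0 xLS xtLS :: "real^'n"
    and M :: "'w measure" and I :: "nat \<Rightarrow> 'w \<Rightarrow> 'm" and k :: nat and \<alpha> \<beta> :: real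
  assumes "At \<noteq> 0"
    and "rk_sampling At M I"
    and "k \<ge> 1"
  defines "xLS \<equiv> pinv A *v b"
    and "xtLS \<equiv> pinv At *v bt"
    and "\<alpha> \<equiv> 1 - (sigma_min At)\<^sup>2 / (frobenius_norm At)\<^sup>2"
    and "\<beta> \<equiv> 1 - (1 - (sigma_max At)\<^sup>2 / (frobenius_norm At)\<^sup>2) ^ k"
  shows "norm (LINT \<omega>|M. rk_iterate At bt x0 (\<lambda>j. I j \<omega>) k - xLS)
    \<le> \<alpha> ^ k * norm (orth_proj (matrix_range (transpose At)) (x0 - xLS))
      + \<beta> * norm (orth_proj (matrix_range (transpose At)) (xLS - xtLS))
      + norm (orth_proj (matrix_null At) (x0 - xLS))"
proof -
  interpret prob_space M using assms(2) by (simp add: rk_sampling_def)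
  let ?R = "matrix_range (transpose At)" and ?N = "matrix_null At"
  let ?T = "mean_error_map At ^^ k"
  note T = linear_mean_error_map_funpow[of k At]
  have R: "orth_proj ?R x \<in> ?R" for x by (rule orth_proj_props(1)[OF subspace_matrix_range])
  have N: "?T (orth_proj ?N x) = orth_proj ?N x" for x
    by (rule mean_error_map_funpow_null[OF orth_proj_props(1)[OF subspace_matrix_null]])
  have split: "?T x = ?T (orth_proj ?R x) + orth_proj ?N x" for x
    using linear_add[OF T, of "orth_proj ?R x" "orth_proj ?N x"] N
    by (simp add: range_null_decomposition)
  have E: "integrable M (\<lambda>\<omega>. rk_iterate At bt x0 (\<lambda>j. I j \<omega>) k)"
    "expectation (\<lambda>\<omega>. rk_iterate At bt x0 (\<lambda>j. I j \<omega>) k) - xtLS = ?T (x0 - xtLS)"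
    using expectation_rk_iterate[OF assms(1,2)] unfolding xtLS_def by blast+
  \<comment> \<open>The recursion for the mean is centred at \<open>xtLS\<close>; re-centring it at \<open>xLS\<close> leaves the defect of
    \<open>?T\<close> from the identity, applied to \<open>xLS - xtLS\<close>. The null space component of this defect is 0.\<close>
  have "(LINT \<omega>|M. rk_iterate At bt x0 (\<lambda>j. I j \<omega>) k - xLS)
      = ?T (x0 - xtLS) - (xLS - xtLS)"
    using E by (simp add: prob_space algebra_simps)
  also have "\<dots> = ?T (x0 - xLS) - ((xLS - xtLS) - ?T (xLS - xtLS))"
    using linear_add[OF T, of "x0 - xLS" "xLS - xtLS"] by simp
  also have "\<dots> = ?T (orth_proj ?R (x0 - xLS))
      - (orth_proj ?R (xLS - xtLS) - ?T (orth_proj ?R (xLS - xtLS))) + orth_proj ?N (x0 - xLS)"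
    using split[of "x0 - xLS"] split[of "xLS - xtLS"] range_null_decomposition[of At "xLS - xtLS"]
    by (simp add: algebra_simps)
  finally have "norm (LINT \<omega>|M. rk_iterate At bt x0 (\<lambda>j. I j \<omega>) k - xLS)
      \<le> norm (?T (orth_proj ?R (x0 - xLS)))
        + norm (orth_proj ?R (xLS - xtLS) - ?T (orth_proj ?R (xLS - xtLS)))
        + norm (orth_proj ?N (x0 - xLS))"
    by (smt (verit) norm_triangle_ineq norm_triangle_ineq4)
  then show ?thesis
    using mean_error_map_range_bounds(1)[OF assms(1) R, of k "x0 - xLS"]
      mean_error_map_range_bounds(2)[OF assms(1) R, of "xLS - xtLS" k]
    unfolding \<alpha>_def \<beta>_def by linarith
qed

end
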